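(* Let $m,n\in\mathbb{N}$ and let $\Phi: M_n(\mathbb{C})\to M_m(\mathbb{C})$ be a positive linear map. If $$\operatorname{Tr}\left[\Phi(K)^* A^{p}\,\Phi(K)B^{1-p}\right]\le \operatorname{Tr}\left[K^* \Phi^\dagger(A)^{p} K\, \Phi^\dagger(B)^{1-p}\right]$$ holds for all $0\le p\le 1$, all $A,B\in M_m^{+}(\mathbb{C})$ and all $K\in M_n(\mathbb{C})$, then $\Phi$ is a Schwarz map. Thus, satisfaction of this inequality (for all such $p,A,B,K$) characterizes the class of Schwarz maps among positive linear maps.
   Context: $M_m(\mathbb{C})$ denotes the $m\times m$ complex matrices, and $M_m^{+}(\mathbb{C})$ the closed cone of positive semidefinite matrices in $M_m(\mathbb{C})$. A linear map $\Phi: M_n(\mathbb{C})\to M_m(\mathbb{C})$ is positive if $\Phi(X)\in M_m^+(\mathbb{C})$ whenever $X\in M_n^+(\mathbb{C})$. Each $M_n(\mathbb{C})$ carries the Hilbert–Schmidt inner product $\langle X,Y\rangle=\operatorname{Tr}[X^*Y]$, and $\Phi^\dagger: M_m(\mathbb{C})\to M_n(\mathbb{C})$ is the adjoint of $\Phi$ with respect to these inner products. A Schwarz map is a linear map $\Phi: M_n(\mathbb{C})\to M_m(\mathbb{C})$ (not necessarily unital) such that $\Phi(K^*K)\ge \Phi(K)^*\Phi(K)$ for all $K\in M_n(\mathbb{C})$. Powers of positive semidefinite matrices are defined by functional calculus, with the convention that the zeroth power of a positive semidefinite matrix is the identity matrix. *)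

theory Defs
  imports "HOL-Analysis.Analysis"
begin

section \<open>Complex matrices\<close>

text \<open>
  Matrices over the complex numbers have type \<open>complex^'n^'n\<close>. Two library defaults are avoided:
  \<open>inner\<close>, \<open>linear\<close> and \<open>adjoint\<close> refer to the underlying real vector space, and
  \<open>\<le>\<close> on vectors and matrices is the entrywise order. On the complex numbers themselves
  \<open>\<le>\<close> is the order of \<open>HOL-Library.Complex_Order\<close> (equal imaginary parts, ordered real parts),
  so that \<open>0 \<le> z\<close> says that \<open>z\<close> is real and nonnegative.
\<close>

definition mscale :: "complex \<Rightarrow> complex^'n^'m \<Rightarrow> complex^'n^'m" where
  "mscale c A = map_matrix (\<lambda>z. c * z) A"

definition cadjoint :: "complex^'n^'m \<Rightarrow> complex^'m^'n" where
  "cadjoint A = transpose (map_matrix cnj A)"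

definition cinner :: "complex^'n \<Rightarrow> complex^'n \<Rightarrow> complex" where
  "cinner x y = (\<Sum>i\<in>UNIV. cnj (x $ i) * y $ i)"

definition psd :: "complex^'n^'n \<Rightarrow> bool" where
  "psd A \<longleftrightarrow> cadjoint A = A \<and> (\<forall>x. 0 \<le> cinner x (A *v x))"

definition loewner_le :: "complex^'n^'n \<Rightarrow> complex^'n^'n \<Rightarrow> bool"  (infix "\<preceq>" 50) where
  "A \<preceq> B \<longleftrightarrow> psd (B - A)"


section \<open>Functional calculus and powers\<close>

definition unitary :: "complex^'n^'n \<Rightarrow> bool" where
  "unitary U \<longleftrightarrow> cadjoint U ** U = mat 1 \<and> U ** cadjoint U = mat 1"

definition real_diag :: "('n \<Rightarrow> real) \<Rightarrow> complex^'n^'n" where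
  "real_diag d = (\<chi> i j. if i = j then complex_of_real (d i) else 0)"

text \<open>
  For a Hermitian \<open>A\<close>, the result does not depend on the chosen diagonalization
  (lemma \<open>hermitian_fun_eq\<close> below). For other matrices the value is unspecified.
\<close>

definition hermitian_fun :: "(real \<Rightarrow> real) \<Rightarrow> complex^'n^'n \<Rightarrow> complex^'n^'n" where
  "hermitian_fun f A =
     (THE C. \<exists>U d. unitary U \<and> A = U ** real_diag d ** cadjoint U \<and>
                   C = U ** real_diag (f \<circ> d) ** cadjoint U)"

text \<open>
  In the library, \<open>0 powr p = 0\<close> for every \<open>p\<close>, including \<open>p = 0\<close>; the case distinction makes the
  zeroth power the identity matrix, for singular \<open>A\<close> as well.
\<close>

definition psd_power :: "complex^'n^'n \<Rightarrow> real \<Rightarrow> complex^'n^'n" where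
  "psd_power A p = hermitian_fun (\<lambda>t. if p = 0 then 1 else t powr p) A"

lemma cadjoint_nth [simp]: "cadjoint A $ i $ j = cnj (A $ j $ i)"
  by (simp add: cadjoint_def transpose_def)

lemma real_diag_mult_left: "(real_diag d ** A) $ i $ j = of_real (d i) * A $ i $ j"
proof -
  have "(real_diag d ** A) $ i $ j = (\<Sum>k\<in>UNIV. if k = i then of_real (d i) * A $ i $ j else 0)"
    unfolding matrix_matrix_mult_def real_diag_def by (simp only: vec_lambda_beta, intro sum.cong) auto
  then show ?thesis by simp
qed

lemma real_diag_mult_right: "(A ** real_diag d) $ i $ j = A $ i $ j * of_real (d j)"
proof -
  have "(A ** real_diag d) $ i $ j = (\<Sum>k\<in>UNIV. if k = j then A $ i $ j * of_real (d j) else 0)"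
    unfolding matrix_matrix_mult_def real_diag_def by (simp only: vec_lambda_beta, intro sum.cong) auto
  then show ?thesis by simp
qed

lemma diagonalization_unique:
  assumes U: "unitary U" and V: "unitary V"
    and eq: "U ** real_diag d ** cadjoint U = V ** real_diag e ** cadjoint V"
  shows "U ** real_diag (f \<circ> d) ** cadjoint U = V ** real_diag (f \<circ> e) ** cadjoint V"
proof -
  define W where "W = cadjoint V ** U"
  have cancel: "cadjoint V ** (U ** D ** cadjoint U) ** U = W ** D" for D
    using U by (simp add: W_def unitary_def flip: matrix_mul_assoc)
  have cancel': "cadjoint V ** (V ** D ** cadjoint V) ** U = D ** W" for D
  proof -
    have "cadjoint V ** (V ** D ** cadjoint V) ** U = (cadjoint V ** V) ** D ** W"
      by (simp add: W_def matrix_mul_assoc)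
    then show ?thesis using V by (simp add: unitary_def)
  qed
  have "W ** real_diag d = real_diag e ** W"
    by (metis cancel cancel' eq)
  then have "W $ i $ j * of_real (d j) = of_real (e i) * W $ i $ j" for i j
    by (metis real_diag_mult_left real_diag_mult_right)
  then have "W $ i $ j = 0 \<or> d j = e i" for i j
    by (metis mult.commute mult_cancel_left of_real_eq_iff)
  then have "W $ i $ j * of_real (f (d j)) = of_real (f (e i)) * W $ i $ j" for i j
    by (metis mult.commute mult_zero_left)
  then have W: "W ** real_diag (f \<circ> d) = real_diag (f \<circ> e) ** W"
    by (simp add: vec_eq_iff real_diag_mult_left real_diag_mult_right)
  have VW: "V ** W = U"
    using V by (simp add: W_def unitary_def matrix_mul_assoc)
  have WU: "W ** cadjoint U = cadjoint V"
    using U by (simp add: W_def unitary_def flip: matrix_mul_assoc)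
  have "U ** real_diag (f \<circ> d) ** cadjoint U = V ** (W ** real_diag (f \<circ> d)) ** cadjoint U"
    by (simp add: matrix_mul_assoc VW)
  also have "\<dots> = V ** real_diag (f \<circ> e) ** (W ** cadjoint U)"
    by (simp add: W matrix_mul_assoc)
  finally show ?thesis by (simp add: WU)
qed

lemma hermitian_fun_eq:
  assumes "unitary U" and "A = U ** real_diag d ** cadjoint U"
  shows "hermitian_fun f A = U ** real_diag (f \<circ> d) ** cadjoint U"
  unfolding hermitian_fun_def
  by (rule the_equality) (use assms diagonalization_unique in blast)+


section \<open>Linear maps between matrix algebras\<close>

abbreviation clinear :: "(complex^'n^'n \<Rightarrow> complex^'m^'m) \<Rightarrow> bool" where
  "clinear \<equiv> Vector_Spaces.linear mscale mscale"

definition positive_map :: "(complex^'n^'n \<Rightarrow> complex^'m^'m) \<Rightarrow> bool" where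
  "positive_map \<Phi> \<longleftrightarrow> clinear \<Phi> \<and> (\<forall>X. psd X \<longrightarrow> psd (\<Phi> X))"

definition schwarz_map :: "(complex^'n^'n \<Rightarrow> complex^'m^'m) \<Rightarrow> bool" where
  "schwarz_map \<Phi> \<longleftrightarrow>
     clinear \<Phi> \<and> (\<forall>K. cadjoint (\<Phi> K) ** \<Phi> K \<preceq> \<Phi> (cadjoint K ** K))"

definition hs_inner :: "complex^'n^'n \<Rightarrow> complex^'n^'n \<Rightarrow> complex" where
  "hs_inner X Y = trace (cadjoint X ** Y)"

definition hs_adjoint ::
    "(complex^'n^'n \<Rightarrow> complex^'m^'m) \<Rightarrow> complex^'m^'m \<Rightarrow> complex^'n^'n" where
  "hs_adjoint \<Phi> = (THE \<Psi>. \<forall>X Y. hs_inner (\<Psi> Y) X = hs_inner Y (\<Phi> X))"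

lemma vector_space_mscale: "vector_space (mscale :: complex \<Rightarrow> complex^'n^'m \<Rightarrow> _)"
  by unfold_locales (simp_all add: mscale_def vec_eq_iff algebra_simps)

lemma Re_hs_inner: "Re (hs_inner X Y) = inner X Y"
proof -
  have "hs_inner X Y = (\<Sum>i\<in>UNIV. \<Sum>k\<in>UNIV. cnj (X $ k $ i) * Y $ k $ i)"
    by (simp add: hs_inner_def trace_def matrix_matrix_mult_def)
  also have "\<dots> = (\<Sum>k\<in>UNIV. \<Sum>i\<in>UNIV. cnj (X $ k $ i) * Y $ k $ i)"
    by (rule sum.swap)
  finally show ?thesis by (simp add: inner_vec_def inner_complex_def)
qed

lemma hs_inner_mscale_right: "hs_inner X (mscale c Y) = c * hs_inner X Y"
  by (simp add: hs_inner_def trace_def matrix_matrix_mult_def mscale_def sum_distrib_left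
      mult.left_commute)

lemma clinear_imp_linear:
  assumes "clinear \<Phi>"
  shows "linear \<Phi>"
proof
  interpret Vector_Spaces.linear mscale mscale \<Phi> by fact
  show "\<Phi> (X + Y) = \<Phi> X + \<Phi> Y" for X Y by (rule add)
  have *: "r *\<^sub>R Z = mscale (of_real r) Z" for r :: real and Z :: "complex^'k^'k"
    by (simp add: mscale_def vec_eq_iff complex_eq_iff)
  show "\<Phi> (r *\<^sub>R X) = r *\<^sub>R \<Phi> X" for r X
    by (simp only: * scale)
qed

lemma hs_adjoint_works:
  assumes "clinear \<Phi>"
  shows "hs_inner (hs_adjoint \<Phi> Y) X = hs_inner Y (\<Phi> X)"
proof -
  interpret Vector_Spaces.linear mscale mscale \<Phi> by fact
  have Re: "Re (hs_inner (adjoint \<Phi> Y) X) = Re (hs_inner Y (\<Phi> X))" for X Y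
    using adjoint_works[OF clinear_imp_linear[OF assms], of X Y]
    by (simp add: Re_hs_inner inner_commute)
  have "Im (hs_inner (adjoint \<Phi> Y) X) = Im (hs_inner Y (\<Phi> X))" for X Y
    using Re[of Y "mscale \<i> X"] by (simp add: scale hs_inner_mscale_right)
  with Re have ex: "\<forall>X Y. hs_inner (adjoint \<Phi> Y) X = hs_inner Y (\<Phi> X)"
    by (simp add: complex_eq_iff)
  have "\<forall>X Y. hs_inner (hs_adjoint \<Phi> Y) X = hs_inner Y (\<Phi> X)"
    unfolding hs_adjoint_def
  proof (rule theI[where a = "adjoint \<Phi>"])
    fix \<Psi> assume "\<forall>X Y. hs_inner (\<Psi> Y) X = hs_inner Y (\<Phi> X)"
    with ex have "inner (\<Psi> Y) X = inner (adjoint \<Phi> Y) X" for X Y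
      by (metis Re_hs_inner)
    then have "\<Psi> Y = adjoint \<Phi> Y" for Y
      using vector_eq_rdot[of "\<Psi> Y" "adjoint \<Phi> Y"] by blast
    then show "\<Psi> = adjoint \<Phi>" by (rule ext)
  qed (rule ex)
  then show ?thesis by blast
qed

end

theory Submission
  imports Defs
begin

text \<open>
  The trace inequality at \<open>p = 0\<close> reads \<open>Tr[\<Phi>(K)\<^sup>* \<Phi>(K) B] \<le> Tr[\<Phi>(K\<^sup>* K) B]\<close>. For
  \<open>B = x x\<^sup>*\<close> this is the Schwarz inequality in the direction of the vector \<open>x\<close>, so it implies that
  \<open>\<Phi>\<close> is a Schwarz map (\<open>schwarz_map_if_trace_right\<close>).

  Conversely, pairing the Schwarz inequality with a positive semidefinite matrix gives the case
  \<open>p = 0\<close>. A positive map preserves adjoints, so the same argument at \<open>K\<^sup>*\<close> gives the case \<open>p = 1\<close>.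
  Thus \<open>\<Phi>\<close> is a contraction for two pairs of Hilbert seminorms: from the squared
  seminorms \<open>Tr[K\<^sup>* \<Phi>\<^sup>\<dagger>(A) K]\<close> and \<open>Tr[K\<^sup>* K \<Phi>\<^sup>\<dagger>(B)]\<close> on the domain to \<open>Tr[X\<^sup>* A X]\<close> and
  \<open>Tr[X\<^sup>* X B]\<close> on the codomain. Left multiplication by \<open>A\<close> commutes with right multiplication by
  \<open>B\<close>, so eigenbases of \<open>A\<close> and \<open>B\<close> diagonalize both of the latter at once (\<open>trace_spectral_form\<close>), and
  \<open>Tr[X\<^sup>* A\<^sup>p X B\<^sup>1\<^sup>-\<^sup>p]\<close> is the squared seminorm whose weights are the geometric means of the two given
  families of weights; the same holds on the domain.

  It remains to see that contractivity at the endpoints passes to the geometric means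
  (\<open>weighted_l2_interpolation\<close>). For parallel sums \<open>xy/(x + y)\<close> in place of geometric means this is
  immediate, as these are minima over splittings \<open>v = u + w\<close> of a vector and a linear map carries
  splittings to splittings. The formula
  \<open>x\<^sup>p y\<^sup>1\<^sup>-\<^sup>p = c\<^sub>p \<integral> e\<^bsup>(p-1)s\<^esup> parallel_sum x (e\<^sup>s y) ds\<close> over the real line, for \<open>0 < p < 1\<close>
  (\<open>integral_parallel_sum\<close>), transfers the bound to geometric means.
\<close>

section \<open>Adjoints and positive semidefinite matrices\<close>

lemma cadjoint_cadjoint [simp]: "cadjoint (cadjoint A) = A"
  by (simp add: vec_eq_iff)

lemma cadjoint_mult: "cadjoint (A ** B) = cadjoint B ** cadjoint A"
  by (simp add: vec_eq_iff matrix_matrix_mult_def mult.commute)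

lemma cadjoint_add: "cadjoint (A + B) = cadjoint A + cadjoint B"
  by (simp add: vec_eq_iff)

lemma cadjoint_diff: "cadjoint (A - B) = cadjoint A - cadjoint B"
  by (simp add: vec_eq_iff)

lemma cadjoint_mscale: "cadjoint (mscale c A) = mscale (cnj c) (cadjoint A)"
  by (simp add: vec_eq_iff mscale_def)

lemma cadjoint_mat_1 [simp]: "cadjoint (mat 1) = mat 1"
  by (simp add: vec_eq_iff mat_def)

lemma cinner_matrix_vector_mult: "cinner x (A *v y) = cinner (cadjoint A *v x) y"
  unfolding cinner_def matrix_vector_mult_def
  by (simp add: sum_distrib_left sum_distrib_right mult_ac, rule sum.swap)

lemma cnj_cinner: "cnj (cinner x y) = cinner y x"
  by (simp add: cinner_def mult.commute)

lemma Re_cinner: "Re (cinner x y) = inner x y"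
  by (simp add: cinner_def inner_vec_def inner_complex_def)

lemma cinner_self: "cinner x x = of_real (inner x x)"
  by (simp add: complex_eq_iff Re_cinner) (metis cnj_cinner cnj.sel(2) equal_neg_zero)

lemma psd_conjugate:
  assumes "psd A"
  shows "psd (cadjoint C ** A ** C)"
proof -
  have "cinner x ((cadjoint C ** A ** C) *v x) = cinner (C *v x) (A *v (C *v x))" for x
    by (simp add: cinner_matrix_vector_mult[of "C *v x"] cinner_matrix_vector_mult[of x] cadjoint_mult
        matrix_vector_mul_assoc matrix_mul_assoc)
  with assms show ?thesis
    by (simp add: psd_def cadjoint_mult matrix_mul_assoc)
qed

lemma psd_mat_1: "psd (mat 1)"
  by (simp add: psd_def cinner_self less_eq_complex_def)

lemma psd_gram: "psd (cadjoint C ** C)"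
  using psd_conjugate[OF psd_mat_1, of C] by simp

lemma psd_diagonal_nonneg:
  assumes "psd A"
  shows "0 \<le> A $ i $ i"
proof -
  have "cinner (axis i 1) (A *v axis i 1) = A $ i $ i"
    by (simp add: cinner_def matrix_vector_mult_def axis_def if_distrib[of cnj] if_distrib[of "(*) _"]
        if_distrib[of "\<lambda>x. x * _"] cong: if_cong)
  with assms show ?thesis unfolding psd_def by metis
qed

section \<open>Diagonalization of Hermitian matrices\<close>

text \<open>
  The Rayleigh quotient of \<open>f\<close> attains its maximum \<open>r\<close> on the unit sphere of \<open>W\<close> at some
  \<open>x\<close>. So \<open>g = r - f\<close> is a nonnegative form on \<open>W\<close> that vanishes at \<open>x\<close>, and a nonnegative form
  can only vanish at vectors that \<open>g\<close> kills: otherwise its value at \<open>x + t g(x)\<close> would be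
  negative for small negative \<open>t\<close>.
\<close>

lemma self_adjoint_eigenvector_exists:
  fixes f :: "'a::euclidean_space \<Rightarrow> 'a"
  assumes "linear f" and sym: "\<And>x y. inner x (f y) = inner (f x) y"
    and W: "subspace W" and inv: "f ` W \<subseteq> W" and ne: "W \<noteq> {0}"
  obtains x r where "x \<in> W" "norm x = 1" "f x = r *\<^sub>R x"
proof -
  have "compact (W \<inter> sphere 0 1)"
    using W by (intro closed_Int_compact closed_subspace) simp_all
  moreover obtain y where y: "y \<in> W" "y \<noteq> 0"
    using ne subspace_0[OF W] by blast
  then have "(1 / norm y) *\<^sub>R y \<in> W \<inter> sphere 0 1"
    using W by (simp add: subspace_scale)
  moreover have "continuous_on (W \<inter> sphere 0 1) (\<lambda>x. inner x (f x))"
    using \<open>linear f\<close> by (intro continuous_intros linear_continuous_on) (simp add: linear_conv_bounded_linear)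
  ultimately obtain x where "x \<in> W \<inter> sphere 0 1"
    and max': "\<forall>y\<in>W \<inter> sphere 0 1. inner y (f y) \<le> inner x (f x)"
    using continuous_attains_sup[of "W \<inter> sphere 0 1" "\<lambda>x. inner x (f x)"] by blast
  then have x: "x \<in> W" "norm x = 1" by simp_all
  have max: "inner y (f y) \<le> inner x (f x)" if "y \<in> W" "norm y = 1" for y
    using max' that by simp
  define r where "r = inner x (f x)"
  define g where "g y = r *\<^sub>R y - f y" for y
  have g: "linear g" unfolding g_def using \<open>linear f\<close>
    by (intro linear_compose_sub linear_scale_self)
  have gW: "g y \<in> W" if "y \<in> W" for y
    using that W inv unfolding g_def by (intro subspace_diff subspace_scale) auto
  have g_sym: "inner y (g z) = inner (g y) z" for y z
    by (simp add: g_def sym algebra_simps)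
  have g_nonneg: "0 \<le> inner y (g y)" if "y \<in> W" for y
  proof (cases "y = 0")
    case False
    have "inner (y /\<^sub>R norm y) (f (y /\<^sub>R norm y)) \<le> r"
      unfolding r_def using max[of "y /\<^sub>R norm y"] False that W by (simp add: subspace_scale)
    then have "inner y (f y) \<le> r * (norm y * norm y)"
      using False \<open>linear f\<close> by (simp add: linear_scale field_simps)
    then show ?thesis
      by (simp add: g_def inner_diff_right power2_norm_eq_inner[symmetric] power2_eq_square)
  qed simp
  have gx: "inner x (g x) = 0"
    using x by (simp add: g_def inner_diff_right r_def norm_eq_1)
  define z where "z = g x"
  have "z \<in> W" using x gW by (simp add: z_def)
  have quad: "0 \<le> 2 * t * inner z z + t\<^sup>2 * inner z (g z)" for t
  proof -
    have "0 \<le> inner (x + t *\<^sub>R z) (g (x + t *\<^sub>R z))"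
      using x \<open>z \<in> W\<close> W by (intro g_nonneg subspace_add subspace_scale)
    also have "\<dots> = 2 * t * inner z z + t\<^sup>2 * inner z (g z)"
      using g gx g_sym[of x z]
      by (simp add: linear_add linear_scale inner_add_left inner_add_right z_def[symmetric]
          power2_eq_square algebra_simps)
    finally show ?thesis .
  qed
  have "inner z z = 0"
  proof (rule ccontr)
    assume "inner z z \<noteq> 0"
    then have pos: "0 < inner z z" by simp
    define a where "a = inner z (g z)"
    have "0 \<le> a" unfolding a_def using \<open>z \<in> W\<close> by (rule g_nonneg)
    \<comment> \<open>The shift by 1 keeps the step well defined when the quadratic coefficient is zero.\<close>
    define t where "t = - inner z z / (1 + a)"
    have "t < 0" using pos \<open>0 \<le> a\<close> by (simp add: t_def)
    have "0 \<le> t * (2 * inner z z + t * a)"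
      using quad[of t] by (simp add: a_def power2_eq_square algebra_simps)
    then have "2 * inner z z + t * a \<le> 0"
      using \<open>t < 0\<close> by (simp add: zero_le_mult_iff)
    moreover have "- inner z z \<le> t * a"
      using pos \<open>0 \<le> a\<close> by (simp add: t_def field_simps)
    ultimately show False using pos by simp
  qed
  then have "f x = r *\<^sub>R x" by (simp add: z_def g_def)
  with x show ?thesis by (rule that)
qed

text \<open>
  Complex orthogonality to \<open>u i\<close> is real orthogonality to both \<open>u i\<close> and \<open>\<i> u i\<close>, so the real
  dimension count, \<open>2 |S| < 2 CARD('n)\<close>, provides the vector.
\<close>

lemma cinner_orthogonal_exists:
  fixes u :: "'n::finite \<Rightarrow> complex^'n"
  assumes "S \<noteq> UNIV"
  obtains x where "x \<noteq> 0" "\<And>i. i \<in> S \<Longrightarrow> cinner (u i) x = 0"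
proof -
  define T where "T = u ` S \<union> (\<lambda>i. \<i> *s u i) ` S"
  have "dim T \<le> card T"
    by (rule dim_le_card) (auto simp: T_def span_superset)
  also have "\<dots> \<le> card S + card S"
    unfolding T_def by (intro order.trans[OF card_Un_le] add_mono card_image_le) auto
  also have "\<dots> < DIM(complex^'n)"
  proof -
    have "card S < CARD('n)"
      using assms by (intro psubset_card_mono) auto
    then show ?thesis by simp
  qed
  finally obtain x where x: "x \<noteq> 0" "\<And>y. y \<in> span T \<Longrightarrow> orthogonal x y"
    by (rule orthogonal_to_subspace_exists) blast
  have "cinner (u i) x = 0" if "i \<in> S" for i
  proof -
    have "orthogonal x (u i)" "orthogonal x (\<i> *s u i)"
      using that by (auto intro!: x span_base simp: T_def)
    then have "Re (cinner (u i) x) = 0" "Re (cinner (\<i> *s u i) x) = 0"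
      unfolding orthogonal_def Re_cinner by (simp_all only: inner_commute)
    moreover have "cinner (\<i> *s u i) x = - \<i> * cinner (u i) x"
      by (simp add: cinner_def sum_distrib_left sum_negf mult_ac)
    ultimately show ?thesis by (simp add: complex_eq_iff)
  qed
  with x(1) show ?thesis by (rule that)
qed

lemma cinner_add_right: "cinner x (y + z) = cinner x y + cinner x z"
  by (simp add: cinner_def distrib_left sum.distrib)

lemma cinner_scaleR_right: "cinner x (r *\<^sub>R y) = of_real r * cinner x y"
  by (simp add: cinner_def sum_distrib_left scaleR_conv_of_real[where 'a = complex] mult_ac)

lemma cinner_scaleR_left: "cinner (r *\<^sub>R x) y = of_real r * cinner x y"
  by (simp add: cinner_def sum_distrib_left scaleR_conv_of_real[where 'a = complex] mult_ac)

text \<open>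
  Orthonormal eigenvectors are collected one index at a time: the orthogonal complement of those
  already found is a nonzero invariant subspace, hence contains another eigenvector. Indexing by
  subsets of \<open>'n\<close> makes the vectors the columns of a square matrix once \<open>S\<close> is everything.
\<close>

lemma hermitian_partial_eigenbasis:
  fixes A :: "complex^'n^'n"
  assumes herm: "cadjoint A = A" and "finite S"
  shows "\<exists>(u :: 'n \<Rightarrow> complex^'n) d.
    \<forall>i\<in>S. A *v u i = d i *\<^sub>R u i \<and> (\<forall>j\<in>S. cinner (u i) (u j) = (if i = j then 1 else 0))"
  using \<open>finite S\<close>
proof (induction S rule: finite_induct)
  case (insert k S)
  then obtain u :: "'n \<Rightarrow> complex^'n" and d where
    u: "\<And>i. i \<in> S \<Longrightarrow> A *v u i = d i *\<^sub>R u i"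
    "\<And>i j. i \<in> S \<Longrightarrow> j \<in> S \<Longrightarrow> cinner (u i) (u j) = (if i = j then 1 else 0)"
    by blast
  define W where "W = {x. \<forall>i\<in>S. cinner (u i) x = 0}"
  have "subspace W"
    by (auto simp: subspace_def W_def cinner_add_right cinner_scaleR_right) (simp add: cinner_def)
  moreover have "(*v) A ` W \<subseteq> W"
    by (auto simp: W_def cinner_matrix_vector_mult herm u(1) cinner_scaleR_left)
  moreover have "W \<noteq> {0}"
  proof -
    have "S \<noteq> UNIV" using insert.hyps by auto
    then obtain y where "y \<noteq> 0" "\<And>i. i \<in> S \<Longrightarrow> cinner (u i) y = 0"
      by (rule cinner_orthogonal_exists[where u = u]) blast
    then show ?thesis by (auto simp: W_def)
  qed
  moreover have "inner x (A *v y) = inner (A *v x) y" for x y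
    using arg_cong[OF cinner_matrix_vector_mult[of x A y], of Re] by (simp add: Re_cinner herm)
  ultimately obtain x r where x: "x \<in> W" "norm x = 1" "A *v x = r *\<^sub>R x"
    using self_adjoint_eigenvector_exists[of "(*v) A" W, OF matrix_vector_mul_linear] by metis
  have "cinner x x = 1"
    using x(2) by (simp add: cinner_self norm_eq_1)
  moreover have "cinner (u i) x = 0" "cinner x (u i) = 0" if "i \<in> S" for i
    using x(1) that cnj_cinner[of "u i" x] by (simp_all add: W_def)
  ultimately show ?case
    using x(3) u insert.hyps(2)
    by (intro exI[of _ "u(k := x)"] exI[of _ "d(k := r)"]) auto
qed auto

theorem hermitian_diagonalization:
  fixes A :: "complex^'n^'n"
  assumes "cadjoint A = A"
  obtains U d where "unitary U" "A = U ** real_diag d ** cadjoint U"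
proof -
  obtain u :: "'n \<Rightarrow> complex^'n" and d where
    u: "\<And>i. A *v u i = d i *\<^sub>R u i" "\<And>i j. cinner (u i) (u j) = (if i = j then 1 else 0)"
    using hermitian_partial_eigenbasis[OF assms finite_class.finite_UNIV] by auto
  define U :: "complex^'n^'n" where "U = (\<chi> i j. u j $ i)"
  have "(cadjoint U ** U) $ i $ j = cinner (u i) (u j)" for i j
    by (simp add: matrix_matrix_mult_def cinner_def U_def)
  then have "cadjoint U ** U = mat 1"
    by (simp add: vec_eq_iff u mat_def)
  then have U: "unitary U"
    by (simp add: unitary_def matrix_left_right_inverse)
  have "(A ** U) $ i $ j = (A *v u j) $ i" for i j
    by (simp add: matrix_matrix_mult_def matrix_vector_mult_def U_def)
  then have "A ** U = U ** real_diag d"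
    by (simp add: vec_eq_iff real_diag_mult_right u U_def scaleR_conv_of_real[where 'a = complex] mult.commute)
  then have "U ** real_diag d ** cadjoint U = A ** (U ** cadjoint U)"
    by (simp add: matrix_mul_assoc)
  with U have "A = U ** real_diag d ** cadjoint U" by (simp add: unitary_def)
  with U show ?thesis by (rule that)
qed

corollary psd_diagonalization:
  assumes "psd A"
  obtains U d where "unitary U" "A = U ** real_diag d ** cadjoint U" "\<And>i. 0 \<le> d i"
proof -
  obtain U d where U: "unitary U" and A: "A = U ** real_diag d ** cadjoint U"
    using assms hermitian_diagonalization unfolding psd_def by metis
  have "cadjoint U ** A ** U = (cadjoint U ** U) ** real_diag d ** (cadjoint U ** U)"
    by (simp add: A matrix_mul_assoc)
  with U have "psd (real_diag d)"
    using psd_conjugate[OF assms, of U] by (simp add: unitary_def)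
  then have "0 \<le> d i" for i
    using psd_diagonal_nonneg[of "real_diag d" i] by (simp add: real_diag_def less_eq_complex_def)
  with U A show ?thesis by (rule that)
qed

section \<open>Geometric means as integrals of parallel sums\<close>

text \<open>
  For \<open>0 < p < 1\<close> this is the integrand of \<open>\<integral>\<^sub>0\<^sup>\<infinity> t^(p-1) / (1 + t) dt\<close> after \<open>t = e^s\<close>. In this
  variable, rescaling \<open>t\<close> becomes translation, under which Lebesgue measure is invariant. The value
  of the integral is \<open>\<pi> / sin (\<pi> p)\<close>; only its being finite and positive matters below.
\<close>

definition logistic_kernel :: "real \<Rightarrow> real \<Rightarrow> real" where
  "logistic_kernel p s = exp (p * s) / (1 + exp s)"

lemma logistic_kernel_pos: "0 < logistic_kernel p s"
  by (simp add: logistic_kernel_def add_pos_pos)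

lemma borel_measurable_logistic_kernel [measurable]: "logistic_kernel p \<in> borel_measurable borel"
  unfolding logistic_kernel_def by (intro borel_measurable_continuous_onI continuous_intros)
    (metis add_pos_pos exp_gt_zero less_irrefl zero_less_one)

lemma logistic_kernel_reflect: "logistic_kernel p (- s) = logistic_kernel (1 - p) s"
  by (simp add: logistic_kernel_def exp_minus exp_diff left_diff_distrib field_simps)

text \<open>
  On the right half-line the kernel is dominated by \<open>exp (- (1 - p) s)\<close>. The left half-line reduces
  to this one because reflection exchanges \<open>p\<close> and \<open>1 - p\<close>.
\<close>

lemma integrable_logistic_kernel_atLeast:
  assumes "p < 1"
  shows "integrable lborel (\<lambda>s. indicator {0..} s * logistic_kernel p s)"
proof -
  have "((\<lambda>s. exp (- (1 - p) * s)) has_integral exp (- (1 - p) * 0) / (1 - p)) {0..}"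
    using assms by (intro has_integral_exp_minus_to_infinity) simp
  then have "(\<integral>\<^sup>+s. ennreal (indicator {0..} s * exp (- (1 - p) * s)) \<partial>lborel) < \<infinity>"
    by (subst nn_integral_has_integral_lebesgue) auto
  then have "integrable lborel (\<lambda>s. indicator {0..} s * exp (- (1 - p) * s))"
    by (intro integrableI_nonneg) auto
  then show ?thesis
  proof (rule Bochner_Integration.integrable_bound)
    have "logistic_kernel p s \<le> exp (- (1 - p) * s)" for s
    proof -
      have "logistic_kernel p s \<le> exp (p * s) / exp s"
        unfolding logistic_kernel_def by (intro divide_left_mono) (auto simp: add_pos_pos)
      then show ?thesis by (simp add: exp_diff[symmetric] algebra_simps)
    qed
    then show "AE s in lborel. norm (indicator {0..} s * logistic_kernel p s)
        \<le> norm (indicator {0..} s * exp (- (1 - p) * s))"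
      using logistic_kernel_pos[of p] by (intro always_eventually) (auto simp: abs_mult less_imp_le
          split: split_indicator)
  qed measurable
qed

lemma integrable_logistic_kernel:
  assumes "0 < p" "p < 1"
  shows "integrable lborel (logistic_kernel p)"
proof -
  have "integrable lborel (\<lambda>s. indicator {0..} (0 + (-1) * s) * logistic_kernel (1 - p) (0 + (-1) * s))"
    using assms by (intro lborel_integrable_real_affine[OF integrable_logistic_kernel_atLeast]) auto
  then have "integrable lborel (\<lambda>s. indicator {..0} s * logistic_kernel p s)"
    by (simp add: logistic_kernel_reflect indicator_def cong: if_cong)
  with integrable_logistic_kernel_atLeast[OF assms(2)]
  have "integrable lborel (\<lambda>s. indicator {0..} s * logistic_kernel p s
      + indicator {..0} s * logistic_kernel p s)"
    by (rule Bochner_Integration.integrable_add)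
  then show ?thesis
  proof (rule Bochner_Integration.integrable_bound)
    show "AE s in lborel. norm (logistic_kernel p s) \<le> norm (indicator {0..} s * logistic_kernel p s
        + indicator {..0} s * logistic_kernel p s)"
      using logistic_kernel_pos[of p] by (intro always_eventually) (auto simp: less_imp_le
          split: split_indicator)
  qed measurable
qed

lemma integral_logistic_kernel_pos:
  assumes "0 < p" "p < 1"
  shows "0 < integral\<^sup>L lborel (logistic_kernel p)"
proof -
  have "integral\<^sup>L lborel (logistic_kernel p) \<noteq> 0"
  proof
    assume "integral\<^sup>L lborel (logistic_kernel p) = 0"
    then have "AE s in lborel. logistic_kernel p s = 0"
      using integral_nonneg_eq_0_iff_AE[OF integrable_logistic_kernel[OF assms]]
        logistic_kernel_pos[of p] by (simp add: less_imp_le)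
    then have "AE s in (lborel :: real measure). False"
      by eventually_elim (use logistic_kernel_pos less_irrefl in metis)
    then show False by (simp add: eventually_False ae_filter_eq_bot_iff)
  qed
  moreover have "0 \<le> integral\<^sup>L lborel (logistic_kernel p)"
    using logistic_kernel_pos[of p] by (intro integral_nonneg_AE always_eventually) (simp add: less_imp_le)
  ultimately show ?thesis by simp
qed

text \<open>
  The resistance of \<open>x\<close> and \<open>y\<close> connected in parallel; the value is \<open>0\<close> if both vanish, by the
  convention on division by zero. For nonnegative \<open>x\<close> and \<open>y\<close>, the next two lemmas
  say that \<open>parallel_sum x y * |v|\<^sup>2\<close> is the minimum of \<open>x |u|\<^sup>2 + y |w|\<^sup>2\<close> over all \<open>u + w = v\<close> (Thomson's principle).
\<close>

definition parallel_sum :: "real \<Rightarrow> real \<Rightarrow> real" where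
  "parallel_sum x y = x * y / (x + y)"

lemma parallel_sum_le:
  assumes "0 \<le> x" "0 \<le> y"
  shows "parallel_sum x y * (cmod (u + w))\<^sup>2 \<le> x * (cmod u)\<^sup>2 + y * (cmod w)\<^sup>2"
proof (cases "x + y = 0")
  case False
  have "(cmod (u + w))\<^sup>2 \<le> (cmod u + cmod w)\<^sup>2"
    by (intro power_mono norm_triangle_ineq) auto
  then have "x * y * (cmod (u + w))\<^sup>2 \<le> x * y * (cmod u + cmod w)\<^sup>2"
    using assms by (intro mult_left_mono) auto
  \<comment> \<open>Lagrange's identity: the equality defect in the Cauchy-Schwarz inequality is a square.\<close>
  also have "\<dots> = (x + y) * (x * (cmod u)\<^sup>2 + y * (cmod w)\<^sup>2) - (x * cmod u - y * cmod w)\<^sup>2"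
    by (simp add: power2_eq_square algebra_simps)
  also have "\<dots> \<le> (x + y) * (x * (cmod u)\<^sup>2 + y * (cmod w)\<^sup>2)"
    by simp
  finally show ?thesis
    using False assms by (simp add: parallel_sum_def divide_le_eq mult.commute)
qed (use assms in \<open>simp add: parallel_sum_def\<close>)

lemma parallel_sum_attained:
  assumes "0 \<le> x" "0 \<le> y"
  shows "x * (cmod (of_real (y / (x + y)) * v))\<^sup>2 + y * (cmod (v - of_real (y / (x + y)) * v))\<^sup>2
    = parallel_sum x y * (cmod v)\<^sup>2"
proof (cases "x + y = 0")
  case False
  have "v - of_real (y / (x + y)) * v = of_real (1 - y / (x + y)) * v"
    by (simp add: algebra_simps)
  also have "1 - y / (x + y) = x / (x + y)"
    using False by (simp add: field_simps)
  finally have "x * (cmod (of_real (y / (x + y)) * v))\<^sup>2 + y * (cmod (v - of_real (y / (x + y)) * v))\<^sup>2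
    = (x * (y / (x + y))\<^sup>2 + y * (x / (x + y))\<^sup>2) * (cmod v)\<^sup>2"
    by (simp only: norm_mult norm_of_real power_mult_distrib power2_abs distrib_right mult.assoc)
  also have "x * (y / (x + y))\<^sup>2 + y * (x / (x + y))\<^sup>2 = x * y * (x + y) / (x + y)\<^sup>2"
    by (simp add: power2_eq_square power_divide algebra_simps add_divide_distrib)
  also have "\<dots> = parallel_sum x y"
    by (simp add: parallel_sum_def power2_eq_square)
  finally show ?thesis .
qed (use assms in \<open>simp add: parallel_sum_def\<close>)

text \<open>
  Writing \<open>a\<close> and \<open>b\<close> as exponentials turns the ratio \<open>b / a\<close> into a translation of the kernel.
\<close>

lemma parallel_sum_scaled_eq:
  assumes "0 < a" "0 < b"
  shows "exp ((p - 1) * s) * parallel_sum a (exp s * b)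
    = a powr p * b powr (1 - p) * logistic_kernel p (s + (ln b - ln a))"
proof -
  define x where "x = ln a"
  define y where "y = ln b"
  have ab: "a = exp x" "b = exp y" using assms by (simp_all add: x_def y_def)
  have "exp ((p - 1) * s) * (exp x * (exp s * exp y)) = exp (p * x) * exp ((1 - p) * y) * exp (p * (s + (y - x))) * exp x"
    by (simp add: exp_add[symmetric] algebra_simps)
  moreover have "exp x + exp s * exp y = exp x * (1 + exp (s + (y - x)))"
    by (simp add: distrib_left exp_add[symmetric])
  ultimately show ?thesis
    by (simp add: ab parallel_sum_def powr_def logistic_kernel_def)
qed

text \<open>
  This recovers the weighted geometric mean \<open>a\<^sup>p b\<^sup>1\<^sup>-\<^sup>p\<close> from parallel sums, up to a constant that does
  not depend on \<open>a\<close> and \<open>b\<close>. When \<open>a\<close> or \<open>b\<close> vanishes, both sides are zero, so singular matrices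
  need no approximation argument later.
\<close>

lemma integral_parallel_sum:
  assumes "0 < p" "p < 1" "0 \<le> a" "0 \<le> b"
  shows "has_bochner_integral lborel (\<lambda>s. exp ((p - 1) * s) * parallel_sum a (exp s * b))
    (integral\<^sup>L lborel (logistic_kernel p) * (a powr p * b powr (1 - p)))"
proof (cases "a = 0 \<or> b = 0")
  case True
  then show ?thesis by (auto simp: parallel_sum_def has_bochner_integral_zero)
next
  case False
  with assms have ab: "0 < a" "0 < b" by auto
  define c where "c = ln b - ln a"
  have "has_bochner_integral lborel (logistic_kernel p) (integral\<^sup>L lborel (logistic_kernel p))"
    by (intro has_bochner_integral_integrable integrable_logistic_kernel assms)
  then have "has_bochner_integral lborel (\<lambda>s. logistic_kernel p (c + 1 * s))
      (integral\<^sup>L lborel (logistic_kernel p))"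
    by (subst (asm) lborel_has_bochner_integral_real_affine_iff[where c = 1 and t = c]) simp_all
  then have "has_bochner_integral lborel (\<lambda>s. a powr p * b powr (1 - p) * logistic_kernel p (c + 1 * s))
      (a powr p * b powr (1 - p) * integral\<^sup>L lborel (logistic_kernel p))"
    by (rule has_bochner_integral_mult_right)
  then show ?thesis
    by (simp only: parallel_sum_scaled_eq[OF ab] c_def mult_1 add.commute[of "ln b - ln a"]
        mult.commute[of "integral\<^sup>L lborel _"])
qed

section \<open>Interpolation between weighted sums of squares\<close>

text \<open>
  Split \<open>f = g + h\<close> optimally for the weights \<open>x\<close> and \<open>y\<close>. Then \<open>T f = T g + T h\<close> is an admissible,
  though perhaps not optimal, splitting for the weights \<open>a\<close> and \<open>b\<close>, and it costs no more.
\<close>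

lemma weighted_l2_parallel_sum:
  fixes T :: "('i::finite \<Rightarrow> complex) \<Rightarrow> 'j::finite \<Rightarrow> complex"
  assumes add: "\<And>f g j. T (\<lambda>i. f i + g i) j = T f j + T g j"
    and nonneg: "\<And>i. 0 \<le> x i" "\<And>i. 0 \<le> y i" "\<And>j. 0 \<le> a j" "\<And>j. 0 \<le> b j"
    and bound_x: "\<And>f. (\<Sum>j\<in>UNIV. a j * (cmod (T f j))\<^sup>2) \<le> (\<Sum>i\<in>UNIV. x i * (cmod (f i))\<^sup>2)"
    and bound_y: "\<And>f. (\<Sum>j\<in>UNIV. b j * (cmod (T f j))\<^sup>2) \<le> (\<Sum>i\<in>UNIV. y i * (cmod (f i))\<^sup>2)"
  shows "(\<Sum>j\<in>UNIV. parallel_sum (a j) (b j) * (cmod (T f j))\<^sup>2)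
    \<le> (\<Sum>i\<in>UNIV. parallel_sum (x i) (y i) * (cmod (f i))\<^sup>2)"
proof -
  define g where "g i = of_real (y i / (x i + y i)) * f i" for i
  define h where "h i = f i - g i" for i
  have f: "f = (\<lambda>i. g i + h i)" by (simp add: h_def)
  have "(\<Sum>j\<in>UNIV. parallel_sum (a j) (b j) * (cmod (T f j))\<^sup>2)
      \<le> (\<Sum>j\<in>UNIV. a j * (cmod (T g j))\<^sup>2 + b j * (cmod (T h j))\<^sup>2)"
    unfolding f add using nonneg by (intro sum_mono parallel_sum_le)
  also have "\<dots> \<le> (\<Sum>i\<in>UNIV. x i * (cmod (g i))\<^sup>2 + y i * (cmod (h i))\<^sup>2)"
    unfolding sum.distrib by (intro add_mono bound_x bound_y)
  also have "\<dots> = (\<Sum>i\<in>UNIV. parallel_sum (x i) (y i) * (cmod (f i))\<^sup>2)"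
    unfolding g_def h_def using nonneg by (intro sum.cong refl parallel_sum_attained)
  finally show ?thesis .
qed

text \<open>
  A quadratic form of the Stein-Weiss interpolation theorem, with constant one. The parallel sum of
  \<open>x\<close> and \<open>e\<^sup>s y\<close> gives the quadratic K-functional of the two weighted seminorms, to which the previous
  lemma applies for every \<open>s\<close>; integrating over \<open>s\<close> turns the parallel sums into geometric means,
  and the same constant appears on both sides.
\<close>

theorem weighted_l2_interpolation:
  fixes T :: "('i::finite \<Rightarrow> complex) \<Rightarrow> 'j::finite \<Rightarrow> complex"
  assumes add: "\<And>f g j. T (\<lambda>i. f i + g i) j = T f j + T g j"
    and nonneg: "\<And>i. 0 \<le> x i" "\<And>i. 0 \<le> y i" "\<And>j. 0 \<le> a j" "\<And>j. 0 \<le> b j"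
    and bound_x: "\<And>f. (\<Sum>j\<in>UNIV. a j * (cmod (T f j))\<^sup>2) \<le> (\<Sum>i\<in>UNIV. x i * (cmod (f i))\<^sup>2)"
    and bound_y: "\<And>f. (\<Sum>j\<in>UNIV. b j * (cmod (T f j))\<^sup>2) \<le> (\<Sum>i\<in>UNIV. y i * (cmod (f i))\<^sup>2)"
    and p: "0 < p" "p < 1"
  shows "(\<Sum>j\<in>UNIV. a j powr p * b j powr (1 - p) * (cmod (T f j))\<^sup>2)
    \<le> (\<Sum>i\<in>UNIV. x i powr p * y i powr (1 - p) * (cmod (f i))\<^sup>2)"
proof -
  define c where "c = integral\<^sup>L lborel (logistic_kernel p)"
  have int: "has_bochner_integral lborel
      (\<lambda>s. \<Sum>k\<in>UNIV. exp ((p - 1) * s) * parallel_sum (u k) (exp s * v k) * (cmod (h k))\<^sup>2)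
      (\<Sum>k\<in>UNIV. c * (u k powr p * v k powr (1 - p)) * (cmod (h k))\<^sup>2)"
    if "\<And>k. 0 \<le> u k" "\<And>k. 0 \<le> v k" for u v and h :: "'k::finite \<Rightarrow> complex"
    unfolding c_def using p that
    by (intro has_bochner_integral_sum has_bochner_integral_mult_left integral_parallel_sum)
  have "(\<Sum>j\<in>UNIV. exp ((p - 1) * s) * parallel_sum (a j) (exp s * b j) * (cmod (T f j))\<^sup>2)
      \<le> (\<Sum>i\<in>UNIV. exp ((p - 1) * s) * parallel_sum (x i) (exp s * y i) * (cmod (f i))\<^sup>2)" for s
  proof -
    have "(\<Sum>j\<in>UNIV. parallel_sum (a j) (exp s * b j) * (cmod (T f j))\<^sup>2)
        \<le> (\<Sum>i\<in>UNIV. parallel_sum (x i) (exp s * y i) * (cmod (f i))\<^sup>2)"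
      using nonneg bound_y
      by (intro weighted_l2_parallel_sum add bound_x) (auto simp: mult.assoc sum_distrib_left[symmetric])
    then show ?thesis
      by (simp add: mult.assoc sum_distrib_left[symmetric])
  qed
  then have "(\<Sum>j\<in>UNIV. c * (a j powr p * b j powr (1 - p)) * (cmod (T f j))\<^sup>2)
      \<le> (\<Sum>i\<in>UNIV. c * (x i powr p * y i powr (1 - p)) * (cmod (f i))\<^sup>2)"
    using int[of a b "T f"] int[of x y f] nonneg
    by (metis (no_types, lifting) has_bochner_integral_iff integral_mono)
  then show ?thesis
    using integral_logistic_kernel_pos[OF p] by (simp add: mult.assoc sum_distrib_left[symmetric] c_def)
qed

section \<open>Traces of products and powers\<close>

lemma trace_psd_mult_nonneg:
  fixes A B :: "complex^'n^'n"
  assumes "psd A" "psd B"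
  shows "0 \<le> trace (A ** B)"
proof -
  obtain U d where "unitary U" and A: "A = U ** real_diag d ** cadjoint U" and d: "\<And>i. 0 \<le> d i"
    using psd_diagonalization[OF assms(1)] by metis
  have "trace (A ** B) = trace (U ** (real_diag d ** cadjoint U ** B))"
    by (simp add: A matrix_mul_assoc)
  also have "\<dots> = trace (real_diag d ** (cadjoint U ** B ** U))"
    by (subst trace_mul_sym) (simp add: matrix_mul_assoc)
  also have "\<dots> = (\<Sum>i\<in>UNIV. of_real (d i) * (cadjoint U ** B ** U) $ i $ i)"
    by (simp add: trace_def real_diag_mult_left)
  also have "0 \<le> \<dots>"
    using d psd_conjugate[OF assms(2), of U]
    by (intro sum_nonneg mult_nonneg_nonneg psd_diagonal_nonneg) (simp_all add: less_eq_complex_def)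
  finally show ?thesis .
qed

text \<open>
  The matrix \<open>x x\<^sup>*\<close>. Testing traces against these matrices recovers quadratic forms.
\<close>

definition rank_one :: "complex^'n \<Rightarrow> complex^'n^'n" where
  "rank_one x = (\<chi> i j. x $ i * cnj (x $ j))"

lemma trace_mult_rank_one: "trace (A ** rank_one x) = cinner x (A *v x)"
  by (simp add: trace_def matrix_matrix_mult_def rank_one_def cinner_def matrix_vector_mult_def
      sum_distrib_left mult_ac)

lemma psd_rank_one: "psd (rank_one x)"
proof -
  have "cinner y (rank_one x *v y) = cinner y x * cnj (cinner y x)" for y
    by (simp add: rank_one_def cinner_def matrix_vector_mult_def sum_distrib_left sum_distrib_right mult_ac)
      (rule sum.swap)
  then show ?thesis
    by (simp add: psd_def vec_eq_iff rank_one_def mult.commute complex_norm_square[symmetric])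
       (simp add: less_eq_complex_def complex_mult_cnj)
qed

text \<open>
  For unitary \<open>U\<close> and \<open>V\<close>, the commuting multiplications \<open>X \<mapsto> A X\<close> and \<open>X \<mapsto> X B\<close> by
  \<open>A = U a U\<^sup>*\<close> and \<open>B = V b V\<^sup>*\<close> are simultaneously diagonal: they multiply the entry of
  \<open>U\<^sup>* X V\<close> at \<open>(i, j)\<close> by \<open>a i\<close> and by \<open>b j\<close>.
\<close>

lemma trace_spectral_form:
  "trace (cadjoint X ** (U ** real_diag a ** cadjoint U) ** X ** (V ** real_diag b ** cadjoint V))
    = of_real (\<Sum>k\<in>UNIV. a (fst k) * b (snd k) * (cmod ((cadjoint U ** X ** V) $ fst k $ snd k))\<^sup>2)"
proof -
  define Y where "Y = cadjoint U ** X ** V"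
  have "trace (cadjoint X ** (U ** real_diag a ** cadjoint U) ** X ** (V ** real_diag b ** cadjoint V))
      = trace ((cadjoint X ** U ** real_diag a ** Y ** real_diag b) ** cadjoint V)"
    by (simp add: Y_def matrix_mul_assoc)
  also have "\<dots> = trace (cadjoint Y ** (real_diag a ** Y) ** real_diag b)"
    by (subst trace_mul_sym) (simp add: Y_def matrix_mul_assoc cadjoint_mult)
  also have "\<dots> = (\<Sum>j\<in>UNIV. \<Sum>i\<in>UNIV. of_real (a i * b j * (cmod (Y $ i $ j))\<^sup>2))"
    by (simp add: trace_def real_diag_mult_right matrix_matrix_mult_def[of "cadjoint Y"]
        real_diag_mult_left sum_distrib_left sum_distrib_right complex_norm_square mult_ac
        del: of_real_power)
  also have "\<dots> = (\<Sum>i\<in>UNIV. \<Sum>j\<in>UNIV. of_real (a i * b j * (cmod (Y $ i $ j))\<^sup>2))"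
    by (rule sum.swap)
  finally show ?thesis
    by (simp add: Y_def sum.cartesian_product case_prod_beta)
qed

lemma real_diag_1 [simp]: "real_diag (\<lambda>i. 1) = mat 1"
  by (simp add: real_diag_def mat_def vec_eq_iff)

lemma psd_power_diagonalized:
  assumes "unitary U" "A = U ** real_diag d ** cadjoint U"
  shows "psd_power A p = U ** real_diag (\<lambda>i. if p = 0 then 1 else d i powr p) ** cadjoint U"
  using hermitian_fun_eq[OF assms] by (simp add: psd_power_def comp_def)

lemma psd_power_0:
  assumes "psd A"
  shows "psd_power A 0 = mat 1"
proof -
  obtain U d where "unitary U" "A = U ** real_diag d ** cadjoint U"
    using psd_diagonalization[OF assms] by metis
  then show ?thesis by (simp add: psd_power_diagonalized unitary_def)
qed

lemma psd_power_1:
  assumes "psd A"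
  shows "psd_power A 1 = A"
proof -
  obtain U d where "unitary U" "A = U ** real_diag d ** cadjoint U" "\<And>i. 0 \<le> d i"
    using psd_diagonalization[OF assms] by metis
  then show ?thesis by (simp add: psd_power_diagonalized)
qed

section \<open>Positive maps and their adjoints\<close>

lemma mscale_mult_left: "mscale c A ** B = mscale c (A ** B)"
  by (simp add: vec_eq_iff mscale_def matrix_matrix_mult_def sum_distrib_left mult_ac)

lemma mscale_mult_right: "A ** mscale c B = mscale c (A ** B)"
  by (simp add: vec_eq_iff mscale_def matrix_matrix_mult_def sum_distrib_left mult_ac)

lemma matrix_add_distrib_right: "(A + B) ** C = A ** C + B ** C"
  by (simp add: vec_eq_iff matrix_matrix_mult_def distrib_right sum.distrib)

text \<open>
  In \<open>(X + c)\<^sup>* (X + c) = X\<^sup>* X + c X\<^sup>* + cnj c X + |c|\<^sup>2\<close>, multiplying by \<open>c\<close> and summing over the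
  fourth roots of unity leaves only the term with \<open>X\<close>, because \<open>c\<close> and \<open>c\<^sup>2\<close> sum to zero.
\<close>

lemma gram_polarization:
  fixes X :: "complex^'n^'n"
  shows "mscale 4 X = (\<Sum>c\<in>{1, \<i>, -1, -\<i>}.
    mscale c (cadjoint (X + mscale c (mat 1)) ** (X + mscale c (mat 1))))"
proof -
  have "cadjoint (X + mscale c (mat 1)) ** (X + mscale c (mat 1))
      = cadjoint X ** X + mscale c (cadjoint X) + mscale (cnj c) X + mscale (cnj c * c) (mat 1)" for c
    by (simp add: cadjoint_add cadjoint_mscale matrix_add_ldistrib matrix_add_distrib_right
        mscale_mult_left mscale_mult_right) (simp add: mscale_def vec_eq_iff algebra_simps)
  \<comment> \<open>The first simplification shows that the four roots are distinct, which unfolds the sum.\<close>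
  then show ?thesis
    by (simp add: complex_eq_iff[of _ \<i>] complex_eq_iff[of \<i>] complex_eq_iff[of "- \<i>"] complex_eq_iff[of _ "- \<i>"])
      (simp add: mscale_def vec_eq_iff algebra_simps)
qed

text \<open>
  By polarization every matrix is a combination of positive semidefinite ones, and on those both
  \<open>X\<close> and \<open>\<Phi> X\<close> are Hermitian.
\<close>

lemma positive_map_cadjoint:
  assumes "positive_map \<Phi>"
  shows "\<Phi> (cadjoint X) = cadjoint (\<Phi> X)"
proof -
  interpret Vector_Spaces.linear mscale mscale \<Phi>
    using assms unfolding positive_map_def by blast
  define P where "P c = cadjoint (X + mscale c (mat 1)) ** (X + mscale c (mat 1))" for c
  define C :: "complex set" where "C = {1, \<i>, -1, -\<i>}"
  have X: "mscale 4 X = (\<Sum>c\<in>C. mscale c (P c))"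
    unfolding P_def C_def by (rule gram_polarization)
  have herm: "cadjoint (P c) = P c" "cadjoint (\<Phi> (P c)) = \<Phi> (P c)" for c
    using psd_gram assms unfolding positive_map_def psd_def P_def by blast+
  have cadjoint_sum: "cadjoint (\<Sum>c\<in>C. f c) = (\<Sum>c\<in>C. cadjoint (f c))" for f :: "complex \<Rightarrow> complex^'k^'k"
    by (simp add: vec_eq_iff)
  have "mscale 4 (cadjoint X) = cadjoint (mscale 4 X)"
    by (simp add: cadjoint_mscale)
  also have "\<dots> = (\<Sum>c\<in>C. mscale (cnj c) (P c))"
    by (simp add: X cadjoint_sum cadjoint_mscale herm)
  finally have "mscale 4 (\<Phi> (cadjoint X)) = (\<Sum>c\<in>C. mscale (cnj c) (\<Phi> (P c)))"
    by (metis (no_types, lifting) scale sum sum.cong)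
  moreover have "mscale 4 (\<Phi> X) = (\<Sum>c\<in>C. mscale c (\<Phi> (P c)))"
    using X by (metis (no_types, lifting) scale sum sum.cong)
  then have "cadjoint (mscale 4 (\<Phi> X)) = (\<Sum>c\<in>C. mscale (cnj c) (\<Phi> (P c)))"
    by (simp add: cadjoint_sum cadjoint_mscale herm)
  ultimately have "mscale 4 (\<Phi> (cadjoint X)) = mscale 4 (cadjoint (\<Phi> X))"
    by (simp add: cadjoint_mscale)
  then show ?thesis by (simp add: mscale_def vec_eq_iff)
qed

lemma hs_inner_cadjoint_left: "hs_inner (cadjoint Y) X = cnj (hs_inner Y (cadjoint X))"
proof -
  have "cnj (hs_inner Y (cadjoint X)) = trace (cadjoint (cadjoint Y ** cadjoint X))"
    by (simp add: hs_inner_def trace_def)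
  also have "\<dots> = hs_inner (cadjoint Y) X"
    by (simp add: cadjoint_mult hs_inner_def trace_mul_sym[of X])
  finally show ?thesis by simp
qed

lemma hs_inner_left_eqI:
  assumes "\<And>X. hs_inner Y X = hs_inner Z X"
  shows "Y = Z"
  using assms vector_eq_rdot[of Y Z] by (metis Re_hs_inner)

lemma psd_hs_adjoint:
  assumes \<Phi>: "positive_map \<Phi>" and A: "psd A"
  shows "psd (hs_adjoint \<Phi> A)"
proof -
  let ?M = "hs_adjoint \<Phi> A"
  have adj: "hs_inner ?M X = hs_inner A (\<Phi> X)" for X
    using \<Phi> hs_adjoint_works unfolding positive_map_def by blast
  have "hs_inner (cadjoint ?M) X = hs_inner (cadjoint A) (\<Phi> X)" for X
    by (simp add: hs_inner_cadjoint_left adj positive_map_cadjoint[OF \<Phi>])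
  then have herm: "cadjoint ?M = ?M"
    using A adj by (intro hs_inner_left_eqI) (simp add: psd_def)
  have "0 \<le> cinner x (?M *v x)" for x
  proof -
    have "cinner x (?M *v x) = hs_inner ?M (rank_one x)"
      by (simp add: trace_mult_rank_one[symmetric] hs_inner_def herm)
    also have "\<dots> = trace (A ** \<Phi> (rank_one x))"
      using A unfolding adj by (simp add: hs_inner_def psd_def)
    also have "0 \<le> \<dots>"
      using \<Phi> A psd_rank_one unfolding positive_map_def by (intro trace_psd_mult_nonneg) blast+
    finally show ?thesis .
  qed
  with herm show ?thesis by (simp add: psd_def)
qed

lemma trace_mult_hs_adjoint:
  assumes \<Phi>: "positive_map \<Phi>" and A: "psd A"
  shows "trace (X ** hs_adjoint \<Phi> A) = trace (\<Phi> X ** A)"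
proof -
  have "hs_inner (hs_adjoint \<Phi> A) X = hs_inner A (\<Phi> X)"
    using \<Phi> hs_adjoint_works unfolding positive_map_def by blast
  then show ?thesis
    using A psd_hs_adjoint[OF assms] by (simp add: hs_inner_def psd_def trace_mul_sym[of X] trace_mul_sym[of "\<Phi> X"])
qed

section \<open>Trace inequalities for Schwarz maps\<close>

text \<open>
  Pairing the Schwarz inequality with \<open>B\<close> and moving \<open>\<Phi>\<close> to the other side of the pairing.
\<close>

lemma schwarz_map_trace_right:
  assumes \<Phi>: "positive_map \<Phi>" "schwarz_map \<Phi>" and B: "psd B"
  shows "trace (cadjoint (\<Phi> K) ** \<Phi> K ** B) \<le> trace (cadjoint K ** K ** hs_adjoint \<Phi> B)"
proof -
  have "psd (\<Phi> (cadjoint K ** K) - cadjoint (\<Phi> K) ** \<Phi> K)"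
    using \<Phi>(2) unfolding schwarz_map_def loewner_le_def by blast
  then have "0 \<le> trace ((\<Phi> (cadjoint K ** K) - cadjoint (\<Phi> K) ** \<Phi> K) ** B)"
    using B by (rule trace_psd_mult_nonneg)
  also have "\<dots> = trace (\<Phi> (cadjoint K ** K) ** B) - trace (cadjoint (\<Phi> K) ** \<Phi> K ** B)"
    by (simp add: matrix_matrix_mult_def left_diff_distrib sum_subtractf
        trace_def)
  finally show ?thesis
    using \<Phi>(1) B by (simp add: trace_mult_hs_adjoint)
qed

text \<open>
  The previous lemma at \<open>K\<^sup>*\<close>. Since \<open>\<Phi>\<close> preserves adjoints, the Schwarz inequality also bounds
  \<open>\<Phi>(K) \<Phi>(K)\<^sup>*\<close>, which is what left multiplication by \<open>A\<close> tests.
\<close>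

lemma schwarz_map_trace_left:
  assumes \<Phi>: "positive_map \<Phi>" "schwarz_map \<Phi>" and A: "psd A"
  shows "trace (cadjoint (\<Phi> K) ** A ** \<Phi> K) \<le> trace (cadjoint K ** hs_adjoint \<Phi> A ** K)"
proof -
  have cyclic: "trace (cadjoint X ** M ** X) = trace (X ** cadjoint X ** M)" for X M :: "complex^'k^'k"
    by (subst trace_mul_sym) (simp add: matrix_mul_assoc)
  show ?thesis
    using schwarz_map_trace_right[OF assms, of "cadjoint K"]
    by (simp add: cyclic positive_map_cadjoint[OF \<Phi>(1)])
qed

lemma unitary_conjugate_inverse:
  assumes "unitary U" "unitary V"
  shows "U ** (cadjoint U ** X ** V) ** cadjoint V = X"
proof -
  have "U ** (cadjoint U ** X ** V) ** cadjoint V = (U ** cadjoint U) ** X ** (V ** cadjoint V)"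
    by (simp add: matrix_mul_assoc)
  with assms show ?thesis by (simp add: unitary_def)
qed

lemma unitary_conjugate_inverse':
  assumes "unitary U" "unitary V"
  shows "cadjoint U ** (U ** X ** cadjoint V) ** V = X"
proof -
  have "cadjoint U ** (U ** X ** cadjoint V) ** V = (cadjoint U ** U) ** X ** (cadjoint V ** V)"
    by (simp add: matrix_mul_assoc)
  with assms show ?thesis by (simp add: unitary_def)
qed

text \<open>
  In eigenbases of \<open>A\<close>, \<open>B\<close> and of \<open>\<Phi>\<^sup>\<dagger>(A)\<close>, \<open>\<Phi>\<^sup>\<dagger>(B)\<close>, the map \<open>\<Phi>\<close> acts on the coordinate functions
  indexed by pairs \<open>(i, j)\<close>. The two endpoint trace inequalities are weighted \<open>l\<^sup>2\<close> bounds for this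
  map, and the powers in the claim are the weights of the interpolated bound.
\<close>

lemma schwarz_map_trace_interpolation:
  fixes \<Phi> :: "complex^'n^'n \<Rightarrow> complex^'m^'m"
  assumes \<Phi>: "positive_map \<Phi>" "schwarz_map \<Phi>" and psd: "psd A" "psd B" and p: "0 < p" "p < 1"
  shows "trace (cadjoint (\<Phi> K) ** psd_power A p ** \<Phi> K ** psd_power B (1 - p))
    \<le> trace (cadjoint K ** psd_power (hs_adjoint \<Phi> A) p ** K ** psd_power (hs_adjoint \<Phi> B) (1 - p))"
proof -
  interpret \<Phi>: Vector_Spaces.linear mscale mscale \<Phi>
    using \<Phi>(1) unfolding positive_map_def by blast
  obtain U a where U: "unitary U" and A: "A = U ** real_diag a ** cadjoint U" and a: "\<And>i. 0 \<le> a i"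
    using psd_diagonalization[OF psd(1)] by metis
  obtain V b where V: "unitary V" and B: "B = V ** real_diag b ** cadjoint V" and b: "\<And>i. 0 \<le> b i"
    using psd_diagonalization[OF psd(2)] by metis
  obtain U' x where U': "unitary U'" and A': "hs_adjoint \<Phi> A = U' ** real_diag x ** cadjoint U'"
    and x: "\<And>i. 0 \<le> x i"
    using psd_diagonalization[OF psd_hs_adjoint[OF \<Phi>(1) psd(1)]] by metis
  obtain V' y where V': "unitary V'" and B': "hs_adjoint \<Phi> B = V' ** real_diag y ** cadjoint V'"
    and y: "\<And>i. 0 \<le> y i"
    using psd_diagonalization[OF psd_hs_adjoint[OF \<Phi>(1) psd(2)]] by metis
  \<comment> \<open>Coordinate functions become matrices, and T is the map in these coordinates.\<close>
  define mat_of where "mat_of f = U' ** (\<chi> i j. f (i, j)) ** cadjoint V'" for f :: "'n \<times> 'n \<Rightarrow> complex"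
  define T where "T f k = (cadjoint U ** \<Phi> (mat_of f) ** V) $ fst k $ snd k" for f and k :: "'m \<times> 'm"
  have mat_of_entries: "(cadjoint U' ** mat_of f ** V') $ fst k $ snd k = f k" for f k
    unfolding mat_of_def unitary_conjugate_inverse'[OF U' V'] by simp
  have T_add: "T (\<lambda>k. f k + g k) j = T f j + T g j" for f g j
  proof -
    have "(\<chi> i j. f (i, j) + g (i, j)) = (\<chi> i j. f (i, j)) + (\<chi> i j. g (i, j))"
      by (simp add: vec_eq_iff)
    then have "mat_of (\<lambda>k. f k + g k) = mat_of f + mat_of g"
      by (simp only: mat_of_def matrix_add_ldistrib matrix_add_distrib_right)
    then show ?thesis
      by (simp add: T_def \<Phi>.add matrix_add_ldistrib matrix_add_distrib_right)
  qed
  \<comment> \<open>The constant weight 1 on the other side represents the identity matrix.\<close>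
  have bound_x: "(\<Sum>k\<in>UNIV. a (fst k) * (cmod (T f k))\<^sup>2) \<le> (\<Sum>k\<in>UNIV. x (fst k) * (cmod (f k))\<^sup>2)" for f
    using schwarz_map_trace_left[OF \<Phi> psd(1), of "mat_of f"]
      trace_spectral_form[of "\<Phi> (mat_of f)" U a V "\<lambda>_. 1"]
      trace_spectral_form[of "mat_of f" U' x V' "\<lambda>_. 1"] V V'
    by (simp add: T_def mat_of_entries A[symmetric] A'[symmetric] unitary_def less_eq_complex_def)
  have bound_y: "(\<Sum>k\<in>UNIV. b (snd k) * (cmod (T f k))\<^sup>2) \<le> (\<Sum>k\<in>UNIV. y (snd k) * (cmod (f k))\<^sup>2)" for f
    using schwarz_map_trace_right[OF \<Phi> psd(2), of "mat_of f"]
      trace_spectral_form[of "\<Phi> (mat_of f)" U "\<lambda>_. 1" V b]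
      trace_spectral_form[of "mat_of f" U' "\<lambda>_. 1" V' y] U U'
    by (simp add: T_def mat_of_entries B[symmetric] B'[symmetric] unitary_def less_eq_complex_def)
  define f where "f k = (cadjoint U' ** K ** V') $ fst k $ snd k" for k
  have K: "mat_of f = K"
    using unitary_conjugate_inverse[OF U' V'] by (simp add: mat_of_def f_def)
  have "(\<Sum>k\<in>UNIV. a (fst k) powr p * b (snd k) powr (1 - p) * (cmod (T f k))\<^sup>2)
      \<le> (\<Sum>k\<in>UNIV. x (fst k) powr p * y (snd k) powr (1 - p) * (cmod (f k))\<^sup>2)"
    by (rule weighted_l2_interpolation[where T = T]) (use T_add a b x y bound_x bound_y p in auto)
  then show ?thesis
    using p by (simp add: psd_power_diagonalized[OF U A] psd_power_diagonalized[OF V B]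
        psd_power_diagonalized[OF U' A'] psd_power_diagonalized[OF V' B'] trace_spectral_form
        T_def K f_def less_eq_complex_def)
qed

text \<open>
  For \<open>B = x x\<^sup>*\<close> the trace inequality is the Schwarz inequality evaluated at the vector \<open>x\<close>.
\<close>

lemma schwarz_map_if_trace_right:
  assumes \<Phi>: "positive_map \<Phi>"
    and trace: "\<And>B K. psd B \<Longrightarrow>
      trace (cadjoint (\<Phi> K) ** \<Phi> K ** B) \<le> trace (cadjoint K ** K ** hs_adjoint \<Phi> B)"
  shows "schwarz_map \<Phi>"
proof -
  have "psd (\<Phi> (cadjoint K ** K) - cadjoint (\<Phi> K) ** \<Phi> K)" for K
  proof -
    have "cadjoint (\<Phi> (cadjoint K ** K) - cadjoint (\<Phi> K) ** \<Phi> K)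
        = \<Phi> (cadjoint K ** K) - cadjoint (\<Phi> K) ** \<Phi> K"
      by (simp add: cadjoint_diff cadjoint_mult positive_map_cadjoint[OF \<Phi>, symmetric])
    moreover have "0 \<le> cinner x ((\<Phi> (cadjoint K ** K) - cadjoint (\<Phi> K) ** \<Phi> K) *v x)" for x
    proof -
      have "trace (cadjoint (\<Phi> K) ** \<Phi> K ** rank_one x) \<le> trace (\<Phi> (cadjoint K ** K) ** rank_one x)"
        using trace[OF psd_rank_one] by (simp add: trace_mult_hs_adjoint[OF \<Phi> psd_rank_one])
      then show ?thesis
        by (simp add: trace_mult_rank_one matrix_vector_mult_diff_rdistrib cinner_def right_diff_distrib
            sum_subtractf)
    qed
    ultimately show ?thesis by (simp add: psd_def)
  qed
  with \<Phi> show ?thesis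
    by (simp add: schwarz_map_def loewner_le_def positive_map_def)
qed

section \<open>Characterization of Schwarz maps\<close>

theorem theorem1p5:
  fixes \<Phi> :: "complex^'n^'n \<Rightarrow> complex^'m^'m"
  assumes "positive_map \<Phi>"
  shows "(\<forall>(p::real) A B K. 0 \<le> p \<and> p \<le> 1 \<and> psd A \<and> psd B \<longrightarrow>
            trace (cadjoint (\<Phi> K) ** psd_power A p ** \<Phi> K ** psd_power B (1 - p))
            \<le> trace (cadjoint K ** psd_power (hs_adjoint \<Phi> A) p ** K
                        ** psd_power (hs_adjoint \<Phi> B) (1 - p)))
         \<longleftrightarrow> schwarz_map \<Phi>"
  (is "?ineq \<longleftrightarrow> _")
proof
  \<comment> \<open>At p = 0 the factor with A is the identity, and the inequality is the Schwarz inequality tested against B.\<close>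
  assume ineq: ?ineq
  show "schwarz_map \<Phi>"
  proof (rule schwarz_map_if_trace_right[OF assms])
    fix B :: "complex^'m^'m" and K assume "psd B"
    then show "trace (cadjoint (\<Phi> K) ** \<Phi> K ** B) \<le> trace (cadjoint K ** K ** hs_adjoint \<Phi> B)"
      using ineq[rule_format, of 0 B B K] psd_hs_adjoint[OF assms \<open>psd B\<close>]
      by (simp add: psd_power_0 psd_power_1)
  qed
next
  assume schwarz: "schwarz_map \<Phi>"
  show ?ineq
  proof (intro allI impI)
    fix p :: real and A B :: "complex^'m^'m" and K
    assume *: "0 \<le> p \<and> p \<le> 1 \<and> psd A \<and> psd B"
    then have psd: "psd A" "psd B" "psd (hs_adjoint \<Phi> A)" "psd (hs_adjoint \<Phi> B)"
      using psd_hs_adjoint[OF assms] by auto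
    \<comment> \<open>The interpolation excludes the endpoints, where the zeroth power is the identity even for singular matrices.\<close>
    from * consider "p = 0" | "0 < p" "p < 1" | "p = 1" by linarith
    then show "trace (cadjoint (\<Phi> K) ** psd_power A p ** \<Phi> K ** psd_power B (1 - p))
        \<le> trace (cadjoint K ** psd_power (hs_adjoint \<Phi> A) p ** K ** psd_power (hs_adjoint \<Phi> B) (1 - p))"
    proof cases
      case 1
      then show ?thesis
        using schwarz_map_trace_right[OF assms schwarz psd(2)] psd by (simp add: psd_power_0 psd_power_1)
    next
      case 2
      then show ?thesis
        by (intro schwarz_map_trace_interpolation assms schwarz psd)
    next
      case 3
      then show ?thesis
        using schwarz_map_trace_left[OF assms schwarz psd(1)] psd by (simp add: psd_power_0 psd_power_1)
    qed
  qed
qed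

end
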